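(* Let $F:\mathcal C\to\mathcal D$ and $G:\mathcal D\to\mathcal C$ be functors with $F$ left adjoint to $G$, and denote by $\eta:1_{\mathcal C}\to GF$ and $\varepsilon:FG\to 1_{\mathcal D}$ the unit and counit of the adjunction. (1) Assume given an autoequivalence $\Theta:\mathcal D\to\mathcal D$ and a generating subclass $\mathcal F$ of objects of $\mathcal C$ together with, for any object $P$ of $\mathcal F$, an isomorphism $\theta_P:F(P)\to\Theta F(P)$. Then $F$ is twisted separable with twisted separability datum $(\Theta,\mathcal F,\theta_{-})$ if and only if there exists a natural transformation $\nu:G\Theta F\to 1_{\mathcal C}$ such that for any object $P$ in $\mathcal F$ one has $\nu_P\circ G(\theta_P)\circ\eta_P=\mathrm{id}_P$. (2) Assume given an autoequivalence $\Theta:\mathcal C\to\mathcal C$ and a generating subclass $\mathcal F$ of objects of $\mathcal D$ together with, for any object $P$ of $\mathcal F$, an isomorphism $\theta_P:G(P)\to\Theta G(P)$. Fix a quasi-inverse equivalence $\Theta^{-1}$ to $\Theta$ together with natural isomorphisms $u:1_{\mathcal C}\to\Theta\Theta^{-1}$ and $v:\Theta^{-1}\Theta\to 1_{\mathcal C}$ forming an adjoint equivalence. Then $G$ is twisted separable with twisted separability datum $(\Theta,\mathcal F,\theta_{-})$ if and only if there exists a natural transformation $\xi:1_{\mathcal D}\to F\Theta^{-1}G$ such that for any object $P$ in $\mathcal F$ one has $\varepsilon_P\circ F\big(v_{G(P)}\circ\Theta^{-1}(\theta_P)\big)\circ\xi_P=\mathrm{id}_P$.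
   Context: A subclass $\mathcal F$ of objects of a category $\mathcal C$ is generating if for every object $V$ of $\mathcal C$ there exist an object $P$ of $\mathcal F$ and an epimorphism $P\to V$. A functor $F:\mathcal C\to\mathcal D$ is twisted separable if there exist: (i) an autoequivalence $\Theta$ of $\mathcal D$; (ii) a generating subclass $\mathcal F$ of objects of $\mathcal C$ together with, for any object $P$ of $\mathcal F$, an isomorphism $\theta_P:F(P)\to\Theta F(P)$; (iii) a natural morphism $\mathbf M_{-,-}:\mathrm{Hom}_{\mathcal D}(F(-),\Theta F(-))\to\mathrm{Hom}_{\mathcal C}(-,-)$ such that $\mathbf M_{P,P}(\theta_P)=\mathrm{id}_P$ for any object $P$ of $\mathcal F$. Naturality means: for all morphisms $\alpha:V'\to V$, $\beta:W\to W'$ in $\mathcal C$ and $f:F(V)\to\Theta F(W)$ in $\mathcal D$, $\beta\circ\mathbf M_{V,W}(f)\circ\alpha=\mathbf M_{V',W'}(\Theta F(\beta)\circ f\circ F(\alpha))$. A triple $(\Theta,\mathcal F,\theta_{-})$ as in (i), (ii) for which an $\mathbf M_{-,-}$ as in (iii) exists is called a twisted separability datum for $F$. No naturality of $P\mapsto\theta_P$ is required. "Adjoint equivalence" in (2) means that $\Theta^{-1}$ is left adjoint to $\Theta$ with unit $u$ and counit $v$, i.e. $\Theta(v_X)\circ u_{\Theta(X)}=\mathrm{id}_{\Theta(X)}$ and $v_{\Theta^{-1}(X)}\circ\Theta^{-1}(u_X)=\mathrm{id}_{\Theta^{-1}(X)}$ for every object $X$ of $\mathcal C$. *)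

theory Defs
  imports Main
begin

text \<open>
  A category is given by a carrier of objects and a carrier of arrows, taken inside two types;
  outside the carriers the operations are unconstrained. Hom-sets of distinct pairs of
  objects are disjoint, because every arrow determines its domain and its codomain.
\<close>

record ('o, 'a) cat =
  Obj :: "'o set"
  Arr :: "'a set"
  Dom :: "'a \<Rightarrow> 'o"
  Cod :: "'a \<Rightarrow> 'o"
  Ident :: "'o \<Rightarrow> 'a"
  Comp :: "'a \<Rightarrow> 'a \<Rightarrow> 'a"  (infixr "\<cdot>\<index>" 70)

definition Hom :: "('o, 'a) cat \<Rightarrow> 'o \<Rightarrow> 'o \<Rightarrow> 'a set" where
  "Hom C X Y = {f \<in> Arr C. Dom C f = X \<and> Cod C f = Y}"

locale category =
  fixes C :: "('o, 'a) cat" (structure)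
  assumes Dom_Obj: "f \<in> Arr C \<Longrightarrow> Dom C f \<in> Obj C"
    and Cod_Obj: "f \<in> Arr C \<Longrightarrow> Cod C f \<in> Obj C"
    and Ident_Hom: "X \<in> Obj C \<Longrightarrow> Ident C X \<in> Hom C X X"
    and Comp_Hom: "f \<in> Hom C X Y \<Longrightarrow> g \<in> Hom C Y Z \<Longrightarrow> g \<cdot> f \<in> Hom C X Z"
    and Comp_Ident: "f \<in> Hom C X Y \<Longrightarrow> f \<cdot> Ident C X = f"
    and Ident_Comp: "f \<in> Hom C X Y \<Longrightarrow> Ident C Y \<cdot> f = f"
    and Comp_assoc: "f \<in> Hom C W X \<Longrightarrow> g \<in> Hom C X Y \<Longrightarrow> h \<in> Hom C Y Z \<Longrightarrow>
      (h \<cdot> g) \<cdot> f = h \<cdot> (g \<cdot> f)"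

definition iso_arr :: "('o, 'a) cat \<Rightarrow> 'o \<Rightarrow> 'o \<Rightarrow> 'a \<Rightarrow> bool" where
  "iso_arr C X Y f \<longleftrightarrow> f \<in> Hom C X Y \<and>
    (\<exists>g \<in> Hom C Y X. g \<cdot>\<^bsub>C\<^esub> f = Ident C X \<and> f \<cdot>\<^bsub>C\<^esub> g = Ident C Y)"

definition epi_arr :: "('o, 'a) cat \<Rightarrow> 'o \<Rightarrow> 'o \<Rightarrow> 'a \<Rightarrow> bool" where
  "epi_arr C X Y f \<longleftrightarrow> f \<in> Hom C X Y \<and>
    (\<forall>Z \<in> Obj C. \<forall>g \<in> Hom C Y Z. \<forall>h \<in> Hom C Y Z.
      g \<cdot>\<^bsub>C\<^esub> f = h \<cdot>\<^bsub>C\<^esub> f \<longrightarrow> g = h)"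

record ('o, 'a, 'p, 'b) functr =
  omap :: "'o \<Rightarrow> 'p"
  amap :: "'a \<Rightarrow> 'b"

definition id_functor :: "('o, 'a, 'o, 'a) functr" where
  "id_functor = \<lparr>omap = (\<lambda>X. X), amap = (\<lambda>f. f)\<rparr>"

definition comp_functor ::
  "('p, 'b, 'q, 'c) functr \<Rightarrow> ('o, 'a, 'p, 'b) functr \<Rightarrow> ('o, 'a, 'q, 'c) functr"
  (infixr "\<circ>\<^sub>F" 55) where
  "G \<circ>\<^sub>F F = \<lparr>omap = (\<lambda>X. omap G (omap F X)), amap = (\<lambda>f. amap G (amap F f))\<rparr>"

locale cat_functor = source: category C + target: category D
  for C :: "('o, 'a) cat" and D :: "('p, 'b) cat" +
  fixes F :: "('o, 'a, 'p, 'b) functr"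
  assumes omap_Obj: "X \<in> Obj C \<Longrightarrow> omap F X \<in> Obj D"
    and amap_Hom: "f \<in> Hom C X Y \<Longrightarrow> amap F f \<in> Hom D (omap F X) (omap F Y)"
    and amap_Ident: "X \<in> Obj C \<Longrightarrow> amap F (Ident C X) = Ident D (omap F X)"
    and amap_Comp: "f \<in> Hom C X Y \<Longrightarrow> g \<in> Hom C Y Z \<Longrightarrow>
      amap F (g \<cdot>\<^bsub>C\<^esub> f) = amap F g \<cdot>\<^bsub>D\<^esub> amap F f"

locale nat_trans = source_functor: cat_functor C D F + target_functor: cat_functor C D G
  for C :: "('o, 'a) cat" and D :: "('p, 'b) cat"
    and F :: "('o, 'a, 'p, 'b) functr" and G :: "('o, 'a, 'p, 'b) functr" +
  fixes \<tau> :: "'o \<Rightarrow> 'b"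
  assumes component_Hom: "X \<in> Obj C \<Longrightarrow> \<tau> X \<in> Hom D (omap F X) (omap G X)"
    and naturality: "f \<in> Hom C X Y \<Longrightarrow>
      amap G f \<cdot>\<^bsub>D\<^esub> \<tau> X = \<tau> Y \<cdot>\<^bsub>D\<^esub> amap F f"

locale nat_iso = nat_trans +
  assumes component_iso: "X \<in> Obj C \<Longrightarrow> iso_arr D (omap F X) (omap G X) (\<tau> X)"

text \<open>The left adjoint \<open>F\<close> is the first of the two functor arguments.\<close>

locale adjunction =
  left: cat_functor C D F + right: cat_functor D C G +
  unit: nat_trans C C id_functor "G \<circ>\<^sub>F F" \<eta> +
  counit: nat_trans D D "F \<circ>\<^sub>F G" id_functor \<epsilon>
  for C :: "('o, 'a) cat" and D :: "('p, 'b) cat"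
    and F :: "('o, 'a, 'p, 'b) functr" and G :: "('p, 'b, 'o, 'a) functr"
    and \<eta> :: "'o \<Rightarrow> 'a" and \<epsilon> :: "'p \<Rightarrow> 'b" +
  assumes triangle_left:
      "X \<in> Obj C \<Longrightarrow> \<epsilon> (omap F X) \<cdot>\<^bsub>D\<^esub> amap F (\<eta> X) = Ident D (omap F X)"
    and triangle_right:
      "Y \<in> Obj D \<Longrightarrow> amap G (\<epsilon> Y) \<cdot>\<^bsub>C\<^esub> \<eta> (omap G Y) = Ident C (omap G Y)"

locale adjoint_equivalence =
  adjunction C D F G \<eta> \<epsilon> +
  unit: nat_iso C C id_functor "G \<circ>\<^sub>F F" \<eta> +
  counit: nat_iso D D "F \<circ>\<^sub>F G" id_functor \<epsilon>
  for C :: "('o, 'a) cat" and D :: "('p, 'b) cat"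
    and F :: "('o, 'a, 'p, 'b) functr" and G :: "('p, 'b, 'o, 'a) functr"
    and \<eta> :: "'o \<Rightarrow> 'a" and \<epsilon> :: "'p \<Rightarrow> 'b"

definition autoequivalence :: "('o, 'a) cat \<Rightarrow> ('o, 'a, 'o, 'a) functr \<Rightarrow> bool" where
  "autoequivalence C \<Theta> \<longleftrightarrow> cat_functor C C \<Theta> \<and>
    (\<exists>\<Theta>' u v. cat_functor C C \<Theta>' \<and>
      nat_iso C C id_functor (\<Theta> \<circ>\<^sub>F \<Theta>') u \<and> nat_iso C C (\<Theta>' \<circ>\<^sub>F \<Theta>) id_functor v)"

definition generating :: "('o, 'a) cat \<Rightarrow> 'o set \<Rightarrow> bool" where
  "generating C \<F> \<longleftrightarrow> \<F> \<subseteq> Obj C \<and> (\<forall>V \<in> Obj C. \<exists>P \<in> \<F>. \<exists>f. epi_arr C P V f)"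

text \<open>
  The maps \<open>M V W\<close> form a natural morphism
  \<open>Hom D (F -) (\<Theta> F -) \<rightarrow> Hom C - -\<close> of functors in two variables.
\<close>

definition natural_hom_morphism ::
  "('o, 'a) cat \<Rightarrow> ('p, 'b) cat \<Rightarrow> ('o, 'a, 'p, 'b) functr \<Rightarrow> ('p, 'b, 'p, 'b) functr \<Rightarrow>
   ('o \<Rightarrow> 'o \<Rightarrow> 'b \<Rightarrow> 'a) \<Rightarrow> bool" where
  "natural_hom_morphism C D F \<Theta> M \<longleftrightarrow>
    (\<forall>V \<in> Obj C. \<forall>W \<in> Obj C. \<forall>f \<in> Hom D (omap F V) (omap \<Theta> (omap F W)).
      M V W f \<in> Hom C V W) \<and>
    (\<forall>V' \<in> Obj C. \<forall>V \<in> Obj C. \<forall>W \<in> Obj C. \<forall>W' \<in> Obj C.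
      \<forall>\<alpha> \<in> Hom C V' V. \<forall>\<beta> \<in> Hom C W W'. \<forall>f \<in> Hom D (omap F V) (omap \<Theta> (omap F W)).
      \<beta> \<cdot>\<^bsub>C\<^esub> M V W f \<cdot>\<^bsub>C\<^esub> \<alpha> =
      M V' W' (amap \<Theta> (amap F \<beta>) \<cdot>\<^bsub>D\<^esub> f \<cdot>\<^bsub>D\<^esub> amap F \<alpha>))"

definition twisted_separability_datum ::
  "('o, 'a) cat \<Rightarrow> ('p, 'b) cat \<Rightarrow> ('o, 'a, 'p, 'b) functr \<Rightarrow>
   ('p, 'b, 'p, 'b) functr \<Rightarrow> 'o set \<Rightarrow> ('o \<Rightarrow> 'b) \<Rightarrow> bool" where
  "twisted_separability_datum C D F \<Theta> \<F> \<theta> \<longleftrightarrow>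
    autoequivalence D \<Theta> \<and> generating C \<F> \<and>
    (\<forall>P \<in> \<F>. iso_arr D (omap F P) (omap \<Theta> (omap F P)) (\<theta> P)) \<and>
    (\<exists>M. natural_hom_morphism C D F \<Theta> M \<and> (\<forall>P \<in> \<F>. M P P (\<theta> P) = Ident C P))"

definition twisted_separable ::
  "('o, 'a) cat \<Rightarrow> ('p, 'b) cat \<Rightarrow> ('o, 'a, 'p, 'b) functr \<Rightarrow> bool" where
  "twisted_separable C D F \<longleftrightarrow> (\<exists>\<Theta> \<F> \<theta>. twisted_separability_datum C D F \<Theta> \<F> \<theta>)"

end

theory Submission
  imports Defs
begin

text \<open>
  For an adjunction \<open>F \<stileturn> G\<close> the Yoneda lemma turns natural maps
  \<open>Hom D (F V) (\<Theta> (F W)) \<cong> Hom C V (G (\<Theta> (F W))) \<rightarrow> Hom C V W\<close> into natural transformations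
  \<open>G \<Theta> F \<rightarrow> 1\<close>: \<open>M\<close> corresponds to \<open>\<nu> W = M (\<epsilon> (\<Theta> (F W)))\<close>, and \<open>M f = \<nu> W \<cdot> G f \<cdot> \<eta> V\<close>.
  Dually, if \<open>\<Theta> G\<close> has a left adjoint \<open>L\<close>, natural maps \<open>Hom C (G V) (\<Theta> (G W)) \<rightarrow> Hom D V W\<close>
  correspond to natural transformations \<open>1 \<rightarrow> L G\<close>. For the second part, \<open>L = F \<Theta>\<inverse>\<close> by composing
  the two given adjunctions.
\<close>

section \<open>Identity functors, composite functors and the ends of an arrow\<close>

lemma omap_id_functor [simp]: "omap id_functor X = X"
  by (simp add: id_functor_def)

lemma amap_id_functor [simp]: "amap id_functor f = f"
  by (simp add: id_functor_def)

lemma omap_comp_functor [simp]: "omap (G \<circ>\<^sub>F F) X = omap G (omap F X)"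
  by (simp add: comp_functor_def)

lemma amap_comp_functor [simp]: "amap (G \<circ>\<^sub>F F) f = amap G (amap F f)"
  by (simp add: comp_functor_def)

lemma (in category) Hom_ObjD:
  assumes "f \<in> Hom C X Y"
  shows "X \<in> Obj C" and "Y \<in> Obj C"
  using assms Dom_Obj Cod_Obj by (auto simp: Hom_def)

lemma cat_functor_id: "category C \<Longrightarrow> cat_functor C C id_functor"
  by (simp add: cat_functor_def cat_functor_axioms_def)

lemma cat_functor_comp:
  assumes "cat_functor B C F" and "cat_functor C D G"
  shows "cat_functor B D (G \<circ>\<^sub>F F)"
proof -
  interpret F: cat_functor B C F by fact
  interpret G: cat_functor C D G by fact
  show ?thesis
    by unfold_locales
      (simp_all add: F.omap_Obj G.omap_Obj F.amap_Ident G.amap_Ident F.amap_Comp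
        G.amap_Comp[OF F.amap_Hom F.amap_Hom] G.amap_Hom[OF F.amap_Hom])
qed

section \<open>Composition of adjunctions\<close>

text \<open>Each new datum is a pasting of the old ones, and each triangle identity reduces to the
  triangles of the inner pair \<open>F\<close>, \<open>G\<close> and of the outer pair
  \<open>F'\<close>, \<open>G'\<close>. The unit and counit are given explicitly because the second
  criterion is a formula in which the counit of the composite pair has to be recognised.\<close>

lemma adjunction_comp:
  assumes "adjunction B C F G \<eta> \<epsilon>" and "adjunction C D F' G' \<eta>' \<epsilon>'"
  shows "adjunction B D (F' \<circ>\<^sub>F F) (G \<circ>\<^sub>F G')
    (\<lambda>X. amap G (\<eta>' (omap F X)) \<cdot>\<^bsub>B\<^esub> \<eta> X) (\<lambda>Y. \<epsilon>' Y \<cdot>\<^bsub>D\<^esub> amap F' (\<epsilon> (omap G' Y)))"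
proof -
  interpret A: adjunction B C F G \<eta> \<epsilon> by fact
  interpret A': adjunction C D F' G' \<eta>' \<epsilon>' by fact
  note functors = A.left.omap_Obj A.right.omap_Obj A'.left.omap_Obj A'.right.omap_Obj
  have L: "cat_functor B D (F' \<circ>\<^sub>F F)"
    by (rule cat_functor_comp[OF A.left.cat_functor_axioms A'.left.cat_functor_axioms])
  have R: "cat_functor D B (G \<circ>\<^sub>F G')"
    by (rule cat_functor_comp[OF A'.right.cat_functor_axioms A.right.cat_functor_axioms])
  note RL = cat_functor_comp[OF L R] and LR = cat_functor_comp[OF R L]
  have \<eta>: "\<eta> X \<in> Hom B X (omap G (omap F X))" if "X \<in> Obj B" for X
    using A.unit.component_Hom[OF that] by simp
  have \<eta>': "\<eta>' X \<in> Hom C X (omap G' (omap F' X))" if "X \<in> Obj C" for X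
    using A'.unit.component_Hom[OF that] by simp
  have \<epsilon>: "\<epsilon> X \<in> Hom C (omap F (omap G X)) X" if "X \<in> Obj C" for X
    using A.counit.component_Hom[OF that] by simp
  have \<epsilon>': "\<epsilon>' X \<in> Hom D (omap F' (omap G' X)) X" if "X \<in> Obj D" for X
    using A'.counit.component_Hom[OF that] by simp
  have G\<eta>': "amap G (\<eta>' (omap F X)) \<in> Hom B (omap G (omap F X)) (omap G (omap G' (omap F' (omap F X))))"
    if "X \<in> Obj B" for X
    using that by (intro A.right.amap_Hom \<eta>' functors)
  have F'\<epsilon>: "amap F' (\<epsilon> (omap G' Y)) \<in> Hom D (omap F' (omap F (omap G (omap G' Y)))) (omap F' (omap G' Y))"
    if "Y \<in> Obj D" for Y
    using that by (intro A'.left.amap_Hom \<epsilon> functors)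
  \<comment> \<open>Naturality of the unit pastes two squares: \<open>G\<close> applied to the
    square of \<open>\<eta>'\<close> at \<open>F f\<close>, and the square of \<open>\<eta>\<close>
    at \<open>f\<close>.\<close>
  have "nat_trans B B id_functor ((G \<circ>\<^sub>F G') \<circ>\<^sub>F (F' \<circ>\<^sub>F F))
      (\<lambda>X. amap G (\<eta>' (omap F X)) \<cdot>\<^bsub>B\<^esub> \<eta> X)"
  proof (rule nat_trans.intro[OF cat_functor_id RL])
    show "nat_trans_axioms B B id_functor ((G \<circ>\<^sub>F G') \<circ>\<^sub>F (F' \<circ>\<^sub>F F))
      (\<lambda>X. amap G (\<eta>' (omap F X)) \<cdot>\<^bsub>B\<^esub> \<eta> X)"
    proof
      fix X assume "X \<in> Obj B"
      then show "amap G (\<eta>' (omap F X)) \<cdot>\<^bsub>B\<^esub> \<eta> X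
          \<in> Hom B (omap id_functor X) (omap ((G \<circ>\<^sub>F G') \<circ>\<^sub>F (F' \<circ>\<^sub>F F)) X)"
        using A.left.source.Comp_Hom[OF \<eta> G\<eta>'] by simp
    next
      fix f X Y assume f: "f \<in> Hom B X Y"
      note X = A.left.source.Hom_ObjD(1)[OF f] and Y = A.left.source.Hom_ObjD(2)[OF f]
      note Ff = A.left.amap_Hom[OF f]
      let ?H = "\<lambda>f. amap G (amap G' (amap F' (amap F f)))"
      have GFf: "amap G (amap F f) \<in> Hom B (omap G (omap F X)) (omap G (omap F Y))"
        by (rule A.right.amap_Hom[OF Ff])
      have Hf: "?H f \<in> Hom B (omap G (omap G' (omap F' (omap F X))))
          (omap G (omap G' (omap F' (omap F Y))))"
        by (intro A.right.amap_Hom A'.right.amap_Hom A'.left.amap_Hom Ff)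
      have "?H f \<cdot>\<^bsub>B\<^esub> amap G (\<eta>' (omap F X)) \<cdot>\<^bsub>B\<^esub> \<eta> X
          = (?H f \<cdot>\<^bsub>B\<^esub> amap G (\<eta>' (omap F X))) \<cdot>\<^bsub>B\<^esub> \<eta> X"
        by (rule A.left.source.Comp_assoc[OF \<eta>[OF X] G\<eta>'[OF X] Hf, symmetric])
      also have "?H f \<cdot>\<^bsub>B\<^esub> amap G (\<eta>' (omap F X))
          = amap G (amap G' (amap F' (amap F f)) \<cdot>\<^bsub>C\<^esub> \<eta>' (omap F X))"
        by (rule A.right.amap_Comp[OF \<eta>'[OF A.left.omap_Obj[OF X]]
              A'.right.amap_Hom[OF A'.left.amap_Hom[OF Ff]], symmetric])
      also have "amap G' (amap F' (amap F f)) \<cdot>\<^bsub>C\<^esub> \<eta>' (omap F X) = \<eta>' (omap F Y) \<cdot>\<^bsub>C\<^esub> amap F f"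
        using A'.unit.naturality[OF Ff] by simp
      also have "amap G \<dots> = amap G (\<eta>' (omap F Y)) \<cdot>\<^bsub>B\<^esub> amap G (amap F f)"
        by (rule A.right.amap_Comp[OF Ff \<eta>'[OF A.left.omap_Obj[OF Y]]])
      also have "\<dots> \<cdot>\<^bsub>B\<^esub> \<eta> X = amap G (\<eta>' (omap F Y)) \<cdot>\<^bsub>B\<^esub> amap G (amap F f) \<cdot>\<^bsub>B\<^esub> \<eta> X"
        by (rule A.left.source.Comp_assoc[OF \<eta>[OF X] GFf G\<eta>'[OF Y]])
      also have "amap G (amap F f) \<cdot>\<^bsub>B\<^esub> \<eta> X = \<eta> Y \<cdot>\<^bsub>B\<^esub> f"
        using A.unit.naturality[OF f] by simp
      also have "amap G (\<eta>' (omap F Y)) \<cdot>\<^bsub>B\<^esub> \<dots> = (amap G (\<eta>' (omap F Y)) \<cdot>\<^bsub>B\<^esub> \<eta> Y) \<cdot>\<^bsub>B\<^esub> f"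
        by (rule A.left.source.Comp_assoc[OF f \<eta>[OF Y] G\<eta>'[OF Y], symmetric])
      finally show "amap ((G \<circ>\<^sub>F G') \<circ>\<^sub>F (F' \<circ>\<^sub>F F)) f \<cdot>\<^bsub>B\<^esub> (amap G (\<eta>' (omap F X)) \<cdot>\<^bsub>B\<^esub> \<eta> X)
          = (amap G (\<eta>' (omap F Y)) \<cdot>\<^bsub>B\<^esub> \<eta> Y) \<cdot>\<^bsub>B\<^esub> amap id_functor f"
        by simp
    qed
  \<comment> \<open>The goal left over is \<open>category B\<close>, the premise of
    \<open>cat_functor_id\<close>.\<close>
  qed unfold_locales
  \<comment> \<open>Dually, the squares pasted here are that of \<open>\<epsilon>'\<close> at
    \<open>f\<close> and the image under \<open>F'\<close> of that of \<open>\<epsilon>\<close> at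
    \<open>G' f\<close>.\<close>
  moreover have "nat_trans D D ((F' \<circ>\<^sub>F F) \<circ>\<^sub>F (G \<circ>\<^sub>F G')) id_functor
      (\<lambda>Y. \<epsilon>' Y \<cdot>\<^bsub>D\<^esub> amap F' (\<epsilon> (omap G' Y)))"
  proof (rule nat_trans.intro[OF LR cat_functor_id])
    show "nat_trans_axioms D D ((F' \<circ>\<^sub>F F) \<circ>\<^sub>F (G \<circ>\<^sub>F G')) id_functor
      (\<lambda>Y. \<epsilon>' Y \<cdot>\<^bsub>D\<^esub> amap F' (\<epsilon> (omap G' Y)))"
    proof
      fix X assume "X \<in> Obj D"
      then show "\<epsilon>' X \<cdot>\<^bsub>D\<^esub> amap F' (\<epsilon> (omap G' X))
          \<in> Hom D (omap ((F' \<circ>\<^sub>F F) \<circ>\<^sub>F (G \<circ>\<^sub>F G')) X) (omap id_functor X)"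
        using A'.left.target.Comp_Hom[OF F'\<epsilon> \<epsilon>'] by simp
    next
      fix f X Y assume f: "f \<in> Hom D X Y"
      note X = A'.left.target.Hom_ObjD(1)[OF f] and Y = A'.left.target.Hom_ObjD(2)[OF f]
      note Gf = A'.right.amap_Hom[OF f]
      let ?H = "\<lambda>f. amap F' (amap F (amap G (amap G' f)))"
      have FGf: "amap F' (amap G' f) \<in> Hom D (omap F' (omap G' X)) (omap F' (omap G' Y))"
        by (rule A'.left.amap_Hom[OF Gf])
      have GGf: "amap F (amap G (amap G' f)) \<in> Hom C (omap F (omap G (omap G' X)))
          (omap F (omap G (omap G' Y)))"
        by (intro A.right.amap_Hom A.left.amap_Hom Gf)
      note Hf = A'.left.amap_Hom[OF GGf]
      have "f \<cdot>\<^bsub>D\<^esub> \<epsilon>' X \<cdot>\<^bsub>D\<^esub> amap F' (\<epsilon> (omap G' X))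
          = (f \<cdot>\<^bsub>D\<^esub> \<epsilon>' X) \<cdot>\<^bsub>D\<^esub> amap F' (\<epsilon> (omap G' X))"
        by (rule A'.left.target.Comp_assoc[OF F'\<epsilon>[OF X] \<epsilon>'[OF X] f, symmetric])
      also have "f \<cdot>\<^bsub>D\<^esub> \<epsilon>' X = \<epsilon>' Y \<cdot>\<^bsub>D\<^esub> amap F' (amap G' f)"
        using A'.counit.naturality[OF f] by simp
      also have "\<dots> \<cdot>\<^bsub>D\<^esub> amap F' (\<epsilon> (omap G' X))
          = \<epsilon>' Y \<cdot>\<^bsub>D\<^esub> amap F' (amap G' f) \<cdot>\<^bsub>D\<^esub> amap F' (\<epsilon> (omap G' X))"
        by (rule A'.left.target.Comp_assoc[OF F'\<epsilon>[OF X] FGf \<epsilon>'[OF Y]])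
      also have "amap F' (amap G' f) \<cdot>\<^bsub>D\<^esub> amap F' (\<epsilon> (omap G' X))
          = amap F' (amap G' f \<cdot>\<^bsub>C\<^esub> \<epsilon> (omap G' X))"
        by (rule A'.left.amap_Comp[OF \<epsilon>[OF A'.right.omap_Obj[OF X]] Gf, symmetric])
      also have "amap G' f \<cdot>\<^bsub>C\<^esub> \<epsilon> (omap G' X) = \<epsilon> (omap G' Y) \<cdot>\<^bsub>C\<^esub> amap F (amap G (amap G' f))"
        using A.counit.naturality[OF Gf] by simp
      also have "amap F' \<dots> = amap F' (\<epsilon> (omap G' Y)) \<cdot>\<^bsub>D\<^esub> ?H f"
        by (rule A'.left.amap_Comp[OF GGf \<epsilon>[OF A'.right.omap_Obj[OF Y]]])
      also have "\<epsilon>' Y \<cdot>\<^bsub>D\<^esub> \<dots> = (\<epsilon>' Y \<cdot>\<^bsub>D\<^esub> amap F' (\<epsilon> (omap G' Y))) \<cdot>\<^bsub>D\<^esub> ?H f"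
        by (rule A'.left.target.Comp_assoc[OF Hf F'\<epsilon>[OF Y] \<epsilon>'[OF Y], symmetric])
      finally show "amap id_functor f \<cdot>\<^bsub>D\<^esub> (\<epsilon>' X \<cdot>\<^bsub>D\<^esub> amap F' (\<epsilon> (omap G' X)))
          = (\<epsilon>' Y \<cdot>\<^bsub>D\<^esub> amap F' (\<epsilon> (omap G' Y))) \<cdot>\<^bsub>D\<^esub> amap ((F' \<circ>\<^sub>F F) \<circ>\<^sub>F (G \<circ>\<^sub>F G')) f"
        by simp
    qed
  qed unfold_locales
  moreover have "adjunction_axioms B D (F' \<circ>\<^sub>F F) (G \<circ>\<^sub>F G')
    (\<lambda>X. amap G (\<eta>' (omap F X)) \<cdot>\<^bsub>B\<^esub> \<eta> X) (\<lambda>Y. \<epsilon>' Y \<cdot>\<^bsub>D\<^esub> amap F' (\<epsilon> (omap G' Y)))"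
  proof
    fix X assume X: "X \<in> Obj B"
    let ?FX = "omap F X"
    note FX = A.left.omap_Obj[OF X]
    note F\<eta> = A.left.amap_Hom[OF \<eta>[OF X]]
    have FG\<eta>': "amap F (amap G (\<eta>' ?FX))
        \<in> Hom C (omap F (omap G ?FX)) (omap F (omap G (omap G' (omap F' ?FX))))"
      by (rule A.left.amap_Hom[OF G\<eta>'[OF X]])
    note \<epsilon>2 = \<epsilon>[OF A'.right.omap_Obj[OF A'.left.omap_Obj[OF FX]]]
    note FF\<eta>' = A.left.target.Comp_Hom[OF F\<eta> FG\<eta>']
    \<comment> \<open>First triangle, before \<open>F'\<close> is applied: naturality of
      \<open>\<epsilon>\<close> at \<open>\<eta>' (F X)\<close> moves the counit to the right, where
      the inner triangle at \<open>X\<close> cancels it against \<open>F (\<eta> X)\<close>. What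
      remains is the outer unit at \<open>F X\<close>.\<close>
    have "\<epsilon> (omap G' (omap F' ?FX)) \<cdot>\<^bsub>C\<^esub> amap F (amap G (\<eta>' ?FX) \<cdot>\<^bsub>B\<^esub> \<eta> X)
        = \<epsilon> (omap G' (omap F' ?FX)) \<cdot>\<^bsub>C\<^esub> amap F (amap G (\<eta>' ?FX)) \<cdot>\<^bsub>C\<^esub> amap F (\<eta> X)"
      by (simp only: A.left.amap_Comp[OF \<eta>[OF X] G\<eta>'[OF X]])
    also have "\<dots> = (\<epsilon> (omap G' (omap F' ?FX)) \<cdot>\<^bsub>C\<^esub> amap F (amap G (\<eta>' ?FX))) \<cdot>\<^bsub>C\<^esub> amap F (\<eta> X)"
      by (rule A.left.target.Comp_assoc[OF F\<eta> FG\<eta>' \<epsilon>2, symmetric])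
    also have "\<epsilon> (omap G' (omap F' ?FX)) \<cdot>\<^bsub>C\<^esub> amap F (amap G (\<eta>' ?FX)) = \<eta>' ?FX \<cdot>\<^bsub>C\<^esub> \<epsilon> ?FX"
      using A.counit.naturality[OF \<eta>'[OF FX]] by simp
    also have "\<dots> \<cdot>\<^bsub>C\<^esub> amap F (\<eta> X) = \<eta>' ?FX \<cdot>\<^bsub>C\<^esub> \<epsilon> ?FX \<cdot>\<^bsub>C\<^esub> amap F (\<eta> X)"
      by (rule A.left.target.Comp_assoc[OF F\<eta> \<epsilon>[OF FX] \<eta>'[OF FX]])
    also have "\<epsilon> ?FX \<cdot>\<^bsub>C\<^esub> amap F (\<eta> X) = Ident C ?FX"
      by (rule A.triangle_left[OF X])
    also have "\<eta>' ?FX \<cdot>\<^bsub>C\<^esub> \<dots> = \<eta>' ?FX"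
      by (rule A.left.target.Comp_Ident[OF \<eta>'[OF FX]])
    finally have eq: "\<epsilon> (omap G' (omap F' ?FX)) \<cdot>\<^bsub>C\<^esub> amap F (amap G (\<eta>' ?FX) \<cdot>\<^bsub>B\<^esub> \<eta> X) = \<eta>' ?FX" .
    note h = A.left.amap_Hom[OF A.left.source.Comp_Hom[OF \<eta>[OF X] G\<eta>'[OF X]]]
    \<comment> \<open>Applying \<open>F'\<close> to \<open>eq\<close> turns the last two factors
      into \<open>F' (\<eta>' (F X))\<close>, so that the outer triangle at \<open>F X\<close>
      concludes.\<close>
    have "(\<epsilon>' (omap F' ?FX) \<cdot>\<^bsub>D\<^esub> amap F' (\<epsilon> (omap G' (omap F' ?FX))))
          \<cdot>\<^bsub>D\<^esub> amap F' (amap F (amap G (\<eta>' ?FX) \<cdot>\<^bsub>B\<^esub> \<eta> X))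
        = \<epsilon>' (omap F' ?FX) \<cdot>\<^bsub>D\<^esub> amap F' (\<epsilon> (omap G' (omap F' ?FX)))
          \<cdot>\<^bsub>D\<^esub> amap F' (amap F (amap G (\<eta>' ?FX) \<cdot>\<^bsub>B\<^esub> \<eta> X))"
      by (rule A'.left.target.Comp_assoc[OF A'.left.amap_Hom[OF h] F'\<epsilon> \<epsilon>']) (intro functors X)+
    also have "amap F' (\<epsilon> (omap G' (omap F' ?FX)))
          \<cdot>\<^bsub>D\<^esub> amap F' (amap F (amap G (\<eta>' ?FX) \<cdot>\<^bsub>B\<^esub> \<eta> X)) = amap F' (\<eta>' ?FX)"
      by (simp only: A'.left.amap_Comp[OF h \<epsilon>2, symmetric] eq)
    finally show "(\<epsilon>' (omap (F' \<circ>\<^sub>F F) X) \<cdot>\<^bsub>D\<^esub> amap F' (\<epsilon> (omap G' (omap (F' \<circ>\<^sub>F F) X))))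
        \<cdot>\<^bsub>D\<^esub> amap (F' \<circ>\<^sub>F F) (amap G (\<eta>' (omap F X)) \<cdot>\<^bsub>B\<^esub> \<eta> X) = Ident D (omap (F' \<circ>\<^sub>F F) X)"
      using A'.triangle_left[OF FX] by simp
  next
    fix Y assume Y: "Y \<in> Obj D"
    let ?GY = "omap G' Y"
    note GY = A'.right.omap_Obj[OF Y]
    note G\<epsilon>' = A'.right.amap_Hom[OF \<epsilon>'[OF Y]]
    have GF\<epsilon>: "amap G' (amap F' (\<epsilon> ?GY))
        \<in> Hom C (omap G' (omap F' (omap F (omap G ?GY)))) (omap G' (omap F' ?GY))"
      by (rule A'.right.amap_Hom[OF F'\<epsilon>[OF Y]])
    note \<eta>2 = \<eta>'[OF A.left.omap_Obj[OF A.right.omap_Obj[OF GY]]]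
    \<comment> \<open>The second triangle runs in the opposite order: naturality of
      \<open>\<eta>'\<close> at \<open>\<epsilon> (G' Y)\<close> and the outer triangle at
      \<open>Y\<close> come first. Applying \<open>G\<close> to the result leaves the inner triangle
      at \<open>G' Y\<close>.\<close>
    have "amap G' (\<epsilon>' Y \<cdot>\<^bsub>D\<^esub> amap F' (\<epsilon> ?GY)) \<cdot>\<^bsub>C\<^esub> \<eta>' (omap F (omap G ?GY))
        = (amap G' (\<epsilon>' Y) \<cdot>\<^bsub>C\<^esub> amap G' (amap F' (\<epsilon> ?GY))) \<cdot>\<^bsub>C\<^esub> \<eta>' (omap F (omap G ?GY))"
      by (simp only: A'.right.amap_Comp[OF F'\<epsilon>[OF Y] \<epsilon>'[OF Y]])
    also have "\<dots> = amap G' (\<epsilon>' Y) \<cdot>\<^bsub>C\<^esub> amap G' (amap F' (\<epsilon> ?GY)) \<cdot>\<^bsub>C\<^esub> \<eta>' (omap F (omap G ?GY))"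
      by (rule A.left.target.Comp_assoc[OF \<eta>2 GF\<epsilon> G\<epsilon>'])
    also have "amap G' (amap F' (\<epsilon> ?GY)) \<cdot>\<^bsub>C\<^esub> \<eta>' (omap F (omap G ?GY)) = \<eta>' ?GY \<cdot>\<^bsub>C\<^esub> \<epsilon> ?GY"
      using A'.unit.naturality[OF \<epsilon>[OF GY]] by simp
    also have "amap G' (\<epsilon>' Y) \<cdot>\<^bsub>C\<^esub> \<dots> = (amap G' (\<epsilon>' Y) \<cdot>\<^bsub>C\<^esub> \<eta>' ?GY) \<cdot>\<^bsub>C\<^esub> \<epsilon> ?GY"
      by (rule A.left.target.Comp_assoc[OF \<epsilon>[OF GY] \<eta>'[OF GY] G\<epsilon>', symmetric])
    also have "amap G' (\<epsilon>' Y) \<cdot>\<^bsub>C\<^esub> \<eta>' ?GY = Ident C ?GY"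
      by (rule A'.triangle_right[OF Y])
    also have "\<dots> \<cdot>\<^bsub>C\<^esub> \<epsilon> ?GY = \<epsilon> ?GY"
      by (rule A.left.target.Ident_Comp[OF \<epsilon>[OF GY]])
    finally have eq: "amap G' (\<epsilon>' Y \<cdot>\<^bsub>D\<^esub> amap F' (\<epsilon> ?GY)) \<cdot>\<^bsub>C\<^esub> \<eta>' (omap F (omap G ?GY)) = \<epsilon> ?GY" .
    note h = A'.right.amap_Hom[OF A'.left.target.Comp_Hom[OF F'\<epsilon>[OF Y] \<epsilon>'[OF Y]]]
    have "amap G (amap G' (\<epsilon>' Y \<cdot>\<^bsub>D\<^esub> amap F' (\<epsilon> ?GY))) \<cdot>\<^bsub>B\<^esub> amap G (\<eta>' (omap F (omap G ?GY)))
          \<cdot>\<^bsub>B\<^esub> \<eta> (omap G ?GY)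
        = (amap G (amap G' (\<epsilon>' Y \<cdot>\<^bsub>D\<^esub> amap F' (\<epsilon> ?GY))) \<cdot>\<^bsub>B\<^esub> amap G (\<eta>' (omap F (omap G ?GY))))
          \<cdot>\<^bsub>B\<^esub> \<eta> (omap G ?GY)"
      by (rule A.left.source.Comp_assoc[OF \<eta> G\<eta>' A.right.amap_Hom[OF h], symmetric])
        (intro functors Y)+
    also have "amap G (amap G' (\<epsilon>' Y \<cdot>\<^bsub>D\<^esub> amap F' (\<epsilon> ?GY))) \<cdot>\<^bsub>B\<^esub> amap G (\<eta>' (omap F (omap G ?GY)))
        = amap G (\<epsilon> ?GY)"
      by (simp only: A.right.amap_Comp[OF \<eta>2 h, symmetric] eq)
    finally show "amap (G \<circ>\<^sub>F G') (\<epsilon>' Y \<cdot>\<^bsub>D\<^esub> amap F' (\<epsilon> (omap G' Y)))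
        \<cdot>\<^bsub>B\<^esub> (amap G (\<eta>' (omap F (omap (G \<circ>\<^sub>F G') Y))) \<cdot>\<^bsub>B\<^esub> \<eta> (omap (G \<circ>\<^sub>F G') Y))
        = Ident B (omap (G \<circ>\<^sub>F G') Y)"
      using A.triangle_right[OF GY] by simp
  qed
  ultimately show ?thesis
    by (intro adjunction.intro L R)
qed

section \<open>Natural morphisms of Hom-sets, one variable at a time\<close>

lemma natural_hom_morphism_Hom:
  "natural_hom_morphism C D F \<Theta> M \<Longrightarrow> V \<in> Obj C \<Longrightarrow> W \<in> Obj C \<Longrightarrow>
    f \<in> Hom D (omap F V) (omap \<Theta> (omap F W)) \<Longrightarrow> M V W f \<in> Hom C V W"
  by (simp add: natural_hom_morphism_def)

text \<open>The conditions on objects in the definition are recovered from \<open>\<alpha>\<close>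
  and \<open>\<beta>\<close>, since an arrow determines its ends.\<close>

lemma natural_hom_morphism_naturality:
  assumes "category C" and "natural_hom_morphism C D F \<Theta> M"
    and \<alpha>: "\<alpha> \<in> Hom C V' V" and \<beta>: "\<beta> \<in> Hom C W W'"
    and f: "f \<in> Hom D (omap F V) (omap \<Theta> (omap F W))"
  shows "\<beta> \<cdot>\<^bsub>C\<^esub> M V W f \<cdot>\<^bsub>C\<^esub> \<alpha> =
    M V' W' (amap \<Theta> (amap F \<beta>) \<cdot>\<^bsub>D\<^esub> f \<cdot>\<^bsub>D\<^esub> amap F \<alpha>)"
  using assms(2) \<alpha> \<beta> f category.Hom_ObjD[OF assms(1) \<alpha>] category.Hom_ObjD[OF assms(1) \<beta>]
  by (simp add: natural_hom_morphism_def)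

text \<open>Naturality with \<open>\<beta>\<close> an identity, which \<open>F\<close> and
  \<open>\<Theta>\<close> preserve. The Yoneda arguments below vary the two variables separately, so
  each gets its own rule.\<close>

lemma natural_hom_morphism_pre:
  assumes "natural_hom_morphism C D F \<Theta> M" "cat_functor C D F" "cat_functor D D \<Theta>"
    and \<alpha>: "\<alpha> \<in> Hom C V' V" and W: "W \<in> Obj C"
    and f: "f \<in> Hom D (omap F V) (omap \<Theta> (omap F W))"
  shows "M V W f \<cdot>\<^bsub>C\<^esub> \<alpha> = M V' W (f \<cdot>\<^bsub>D\<^esub> amap F \<alpha>)"
proof -
  interpret F: cat_functor C D F by fact
  interpret \<Theta>: cat_functor D D \<Theta> by fact
  note V = F.source.Hom_ObjD[OF \<alpha>]
  note Mf = natural_hom_morphism_Hom[OF assms(1) V(2) W f]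
  have "M V W f \<cdot>\<^bsub>C\<^esub> \<alpha> = Ident C W \<cdot>\<^bsub>C\<^esub> M V W f \<cdot>\<^bsub>C\<^esub> \<alpha>"
    using F.source.Ident_Comp[OF F.source.Comp_Hom[OF \<alpha> Mf]] by simp
  also have "\<dots> = M V' W (amap \<Theta> (amap F (Ident C W)) \<cdot>\<^bsub>D\<^esub> f \<cdot>\<^bsub>D\<^esub> amap F \<alpha>)"
    by (rule natural_hom_morphism_naturality[OF F.source.category_axioms assms(1) \<alpha>
          F.source.Ident_Hom[OF W] f])
  also have "\<dots> = M V' W (f \<cdot>\<^bsub>D\<^esub> amap F \<alpha>)"
    using F.target.Ident_Comp[OF F.target.Comp_Hom[OF F.amap_Hom[OF \<alpha>] f]]
    by (simp add: F.amap_Ident \<Theta>.amap_Ident W F.omap_Obj)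
  finally show ?thesis .
qed

text \<open>The companion case, with \<open>\<alpha>\<close> an identity.\<close>

lemma natural_hom_morphism_post:
  assumes "natural_hom_morphism C D F \<Theta> M" "cat_functor C D F" "cat_functor D D \<Theta>"
    and \<beta>: "\<beta> \<in> Hom C W W'" and V: "V \<in> Obj C"
    and f: "f \<in> Hom D (omap F V) (omap \<Theta> (omap F W))"
  shows "\<beta> \<cdot>\<^bsub>C\<^esub> M V W f = M V W' (amap \<Theta> (amap F \<beta>) \<cdot>\<^bsub>D\<^esub> f)"
proof -
  interpret F: cat_functor C D F by fact
  note W = F.source.Hom_ObjD[OF \<beta>]
  note Mf = natural_hom_morphism_Hom[OF assms(1) V W(1) f]
  have "\<beta> \<cdot>\<^bsub>C\<^esub> M V W f = \<beta> \<cdot>\<^bsub>C\<^esub> M V W f \<cdot>\<^bsub>C\<^esub> Ident C V"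
    by (simp add: F.source.Comp_Ident[OF Mf])
  also have "\<dots> = M V W' (amap \<Theta> (amap F \<beta>) \<cdot>\<^bsub>D\<^esub> f \<cdot>\<^bsub>D\<^esub> amap F (Ident C V))"
    by (rule natural_hom_morphism_naturality[OF F.source.category_axioms assms(1)
          F.source.Ident_Hom[OF V] \<beta> f])
  also have "\<dots> = M V W' (amap \<Theta> (amap F \<beta>) \<cdot>\<^bsub>D\<^esub> f)"
    by (simp add: F.amap_Ident V F.target.Comp_Ident[OF f])
  finally show ?thesis .
qed

text \<open>Regrouping for naturality proofs: the pairs \<open>h\<close>, \<open>g\<close> and
  \<open>f\<close>, \<open>e\<close> become adjacent, ready to be rewritten by separate naturality
  squares. Read backwards, it exposes the middle pair \<open>g\<close>, \<open>f\<close>, which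
  functoriality can then merge.\<close>

lemma (in category) Comp4_assoc:
  assumes "e \<in> Hom C V W" "f \<in> Hom C W X" "g \<in> Hom C X Y" "h \<in> Hom C Y Z"
  shows "h \<cdot> (g \<cdot> f) \<cdot> e = (h \<cdot> g) \<cdot> f \<cdot> e"
  using Comp_assoc[OF assms(1,2) assms(3)] Comp_assoc[OF Comp_Hom[OF assms(1,2)] assms(3,4)]
  by simp

section \<open>The criterion for a left adjoint\<close>

text \<open>Yoneda is applied in \<open>V\<close> with \<open>W\<close> fixed; naturality of
  \<open>M\<close> in \<open>W\<close> becomes naturality of \<open>\<nu>\<close>. The conditions on
  \<open>\<F>\<close> correspond because \<open>\<nu> P\<close> composed with
  \<open>G (\<theta> P) \<cdot> \<eta> P\<close>, the transpose of \<open>\<theta> P\<close>, is the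
  value of \<open>M\<close> at \<open>\<theta> P\<close>.\<close>

lemma natural_hom_morphism_iff_counit_transformation:
  assumes "adjunction C D F G \<eta> \<epsilon>" and "cat_functor D D \<Theta>"
    and \<F>: "\<F> \<subseteq> Obj C"
    and \<theta>: "\<And>P. P \<in> \<F> \<Longrightarrow> \<theta> P \<in> Hom D (omap F P) (omap \<Theta> (omap F P))"
  shows "(\<exists>M. natural_hom_morphism C D F \<Theta> M \<and> (\<forall>P \<in> \<F>. M P P (\<theta> P) = Ident C P)) \<longleftrightarrow>
    (\<exists>\<nu>. nat_trans C C (G \<circ>\<^sub>F \<Theta> \<circ>\<^sub>F F) id_functor \<nu> \<and>
      (\<forall>P \<in> \<F>. \<nu> P \<cdot>\<^bsub>C\<^esub> amap G (\<theta> P) \<cdot>\<^bsub>C\<^esub> \<eta> P = Ident C P))"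
    (is "?lhs \<longleftrightarrow> ?rhs")
proof -
  interpret adjunction C D F G \<eta> \<epsilon> by fact
  interpret \<Theta>: cat_functor D D \<Theta> by fact
  note functors = left.omap_Obj right.omap_Obj \<Theta>.omap_Obj
  let ?T = "\<lambda>W. omap \<Theta> (omap F W)"
  let ?t = "\<lambda>f. amap \<Theta> (amap F f)"
  have T: "?t f \<in> Hom D (?T V) (?T W)" if "f \<in> Hom C V W" for f V W
    by (intro \<Theta>.amap_Hom left.amap_Hom that)
  have \<eta>: "\<eta> X \<in> Hom C X (omap G (omap F X))" if "X \<in> Obj C" for X
    using unit.component_Hom[OF that] by simp
  have \<epsilon>: "\<epsilon> X \<in> Hom D (omap F (omap G X)) X" if "X \<in> Obj D" for X
    using counit.component_Hom[OF that] by simp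
  have \<epsilon>_nat: "f \<cdot>\<^bsub>D\<^esub> \<epsilon> X = \<epsilon> Y \<cdot>\<^bsub>D\<^esub> amap F (amap G f)" if "f \<in> Hom D X Y" for f X Y
    using counit.naturality[OF that] by simp
  have \<eta>_nat: "amap G (amap F f) \<cdot>\<^bsub>C\<^esub> \<eta> X = \<eta> Y \<cdot>\<^bsub>C\<^esub> f" if "f \<in> Hom C X Y" for f X Y
    using unit.naturality[OF that] by simp
  show ?thesis
  proof
    assume ?lhs
    then obtain M where M: "natural_hom_morphism C D F \<Theta> M"
      and M\<theta>: "\<And>P. P \<in> \<F> \<Longrightarrow> M P P (\<theta> P) = Ident C P" by blast
    note pre = natural_hom_morphism_pre[OF M left.cat_functor_axioms \<Theta>.cat_functor_axioms]
    note post = natural_hom_morphism_post[OF M left.cat_functor_axioms \<Theta>.cat_functor_axioms]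
    \<comment> \<open>\<open>\<epsilon> (\<Theta> (F W))\<close> is the transpose of the identity of
      \<open>G (\<Theta> (F W))\<close>, hence the universal element at which Yoneda evaluates
      \<open>M\<close>.\<close>
    define \<nu> where "\<nu> W = M (omap G (?T W)) W (\<epsilon> (?T W))" for W
    have \<nu>_Hom: "\<nu> W \<in> Hom C (omap G (?T W)) W" if "W \<in> Obj C" for W
      unfolding \<nu>_def by (intro natural_hom_morphism_Hom[OF M] functors \<epsilon> that)
    have "nat_trans C C (G \<circ>\<^sub>F \<Theta> \<circ>\<^sub>F F) id_functor \<nu>"
    proof (rule nat_trans.intro[OF cat_functor_comp[OF cat_functor_comp[OF
              left.cat_functor_axioms \<Theta>.cat_functor_axioms] right.cat_functor_axioms]
            cat_functor_id[OF left.source.category_axioms]])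
      show "nat_trans_axioms C C (G \<circ>\<^sub>F \<Theta> \<circ>\<^sub>F F) id_functor \<nu>"
      proof
        fix X assume "X \<in> Obj C"
        then show "\<nu> X \<in> Hom C (omap (G \<circ>\<^sub>F \<Theta> \<circ>\<^sub>F F) X) (omap id_functor X)"
          using \<nu>_Hom by simp
      next
        fix f X Y assume f: "f \<in> Hom C X Y"
        note X = left.source.Hom_ObjD(1)[OF f] and Y = left.source.Hom_ObjD(2)[OF f]
        \<comment> \<open>\<open>post\<close> brings \<open>f\<close> into the argument of
          \<open>M\<close>, naturality of \<open>\<epsilon>\<close> carries it across the counit,
          and \<open>pre\<close> takes it out again on the other side.\<close>
        have "f \<cdot>\<^bsub>C\<^esub> \<nu> X = M (omap G (?T X)) Y (?t f \<cdot>\<^bsub>D\<^esub> \<epsilon> (?T X))"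
          unfolding \<nu>_def by (intro post[OF f] functors \<epsilon> X)
        also have "\<dots> = M (omap G (?T X)) Y (\<epsilon> (?T Y) \<cdot>\<^bsub>D\<^esub> amap F (amap G (?t f)))"
          by (simp only: \<epsilon>_nat[OF T[OF f]])
        also have "\<dots> = \<nu> Y \<cdot>\<^bsub>C\<^esub> amap G (?t f)"
          unfolding \<nu>_def
          by (intro pre[symmetric] right.amap_Hom T[OF f] functors \<epsilon> Y)
        finally show "amap id_functor f \<cdot>\<^bsub>C\<^esub> \<nu> X = \<nu> Y \<cdot>\<^bsub>C\<^esub> amap (G \<circ>\<^sub>F \<Theta> \<circ>\<^sub>F F) f"
          by simp
      qed
    qed
    moreover have "\<nu> P \<cdot>\<^bsub>C\<^esub> amap G (\<theta> P) \<cdot>\<^bsub>C\<^esub> \<eta> P = Ident C P" if "P \<in> \<F>" for P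
    proof -
      have P: "P \<in> Obj C" using \<F> that by blast
      note \<theta>P = \<theta>[OF that]
      note FP = left.omap_Obj[OF P]
      note G\<theta> = right.amap_Hom[OF \<theta>P]
      \<comment> \<open>After \<open>pre\<close> has absorbed the transpose of
        \<open>\<theta> P\<close> into the argument of \<open>M\<close>, it remains to see that
        transposing back returns \<open>\<theta> P\<close>: this is naturality of
        \<open>\<epsilon>\<close> at \<open>\<theta> P\<close> and the left triangle.\<close>
      have "\<nu> P \<cdot>\<^bsub>C\<^esub> amap G (\<theta> P) \<cdot>\<^bsub>C\<^esub> \<eta> P
          = M P P (\<epsilon> (?T P) \<cdot>\<^bsub>D\<^esub> amap F (amap G (\<theta> P) \<cdot>\<^bsub>C\<^esub> \<eta> P))"
        unfolding \<nu>_def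
        by (rule pre[OF left.source.Comp_Hom[OF \<eta>[OF P] G\<theta>] P]) (intro functors \<epsilon> P)
      also have "amap F (amap G (\<theta> P) \<cdot>\<^bsub>C\<^esub> \<eta> P) = amap F (amap G (\<theta> P)) \<cdot>\<^bsub>D\<^esub> amap F (\<eta> P)"
        by (rule left.amap_Comp[OF \<eta>[OF P] G\<theta>])
      also have "\<epsilon> (?T P) \<cdot>\<^bsub>D\<^esub> \<dots> = (\<epsilon> (?T P) \<cdot>\<^bsub>D\<^esub> amap F (amap G (\<theta> P))) \<cdot>\<^bsub>D\<^esub> amap F (\<eta> P)"
        by (rule left.target.Comp_assoc[symmetric, OF left.amap_Hom[OF \<eta>[OF P]]
              left.amap_Hom[OF G\<theta>] \<epsilon>]) (intro functors P)
      also have "\<epsilon> (?T P) \<cdot>\<^bsub>D\<^esub> amap F (amap G (\<theta> P)) = \<theta> P \<cdot>\<^bsub>D\<^esub> \<epsilon> (omap F P)"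
        by (rule \<epsilon>_nat[OF \<theta>P, symmetric])
      also have "\<dots> \<cdot>\<^bsub>D\<^esub> amap F (\<eta> P) = \<theta> P \<cdot>\<^bsub>D\<^esub> \<epsilon> (omap F P) \<cdot>\<^bsub>D\<^esub> amap F (\<eta> P)"
        by (rule left.target.Comp_assoc[OF left.amap_Hom[OF \<eta>[OF P]] \<epsilon>[OF FP] \<theta>P])
      also have "\<dots> = \<theta> P"
        by (simp only: triangle_left[OF P] left.target.Comp_Ident[OF \<theta>P])
      finally show ?thesis using M\<theta>[OF that] by simp
    qed
    ultimately show ?rhs by blast
  next
    assume ?rhs
    then obtain \<nu> where "nat_trans C C (G \<circ>\<^sub>F \<Theta> \<circ>\<^sub>F F) id_functor \<nu>"
      and \<nu>\<theta>: "\<And>P. P \<in> \<F> \<Longrightarrow> \<nu> P \<cdot>\<^bsub>C\<^esub> amap G (\<theta> P) \<cdot>\<^bsub>C\<^esub> \<eta> P = Ident C P" by blast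
    interpret \<nu>: nat_trans C C "G \<circ>\<^sub>F \<Theta> \<circ>\<^sub>F F" id_functor \<nu> by fact
    have \<nu>: "\<nu> W \<in> Hom C (omap G (?T W)) W" if "W \<in> Obj C" for W
      using \<nu>.component_Hom[OF that] by simp
    have \<nu>_nat: "f \<cdot>\<^bsub>C\<^esub> \<nu> X = \<nu> Y \<cdot>\<^bsub>C\<^esub> amap G (?t f)" if "f \<in> Hom C X Y" for f X Y
      using \<nu>.naturality[OF that] by simp
    \<comment> \<open>The witness transposes \<open>f\<close> to an arrow from \<open>V\<close> to
      \<open>G (\<Theta> (F W))\<close> and follows it by \<open>\<nu> W\<close>.\<close>
    have "natural_hom_morphism C D F \<Theta> (\<lambda>V W f. \<nu> W \<cdot>\<^bsub>C\<^esub> amap G f \<cdot>\<^bsub>C\<^esub> \<eta> V)"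
      unfolding natural_hom_morphism_def
    proof (intro conjI ballI)
      fix V W f assume "V \<in> Obj C" "W \<in> Obj C" "f \<in> Hom D (omap F V) (?T W)"
      then show "\<nu> W \<cdot>\<^bsub>C\<^esub> amap G f \<cdot>\<^bsub>C\<^esub> \<eta> V \<in> Hom C V W"
        by (meson left.source.Comp_Hom \<eta> \<nu> right.amap_Hom)
    next
      fix V' V W W' \<alpha> \<beta> f
      assume V': "V' \<in> Obj C" and V: "V \<in> Obj C" and W: "W \<in> Obj C" and W': "W' \<in> Obj C"
        and \<alpha>: "\<alpha> \<in> Hom C V' V" and \<beta>: "\<beta> \<in> Hom C W W'"
        and f: "f \<in> Hom D (omap F V) (?T W)"
      note Gf = right.amap_Hom[OF f]
      note Gf\<eta> = left.source.Comp_Hom[OF \<eta>[OF V] Gf]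
      note F\<alpha> = left.amap_Hom[OF \<alpha>]
      note GF\<alpha> = right.amap_Hom[OF F\<alpha>]
      note G\<beta> = right.amap_Hom[OF T[OF \<beta>]]
      note f\<alpha> = left.target.Comp_Hom[OF F\<alpha> f]
      note Gf\<alpha> = right.amap_Hom[OF f\<alpha>]
      \<comment> \<open>Naturality of \<open>\<eta>\<close> moves \<open>\<alpha>\<close> under
        \<open>G\<close>, naturality of \<open>\<nu>\<close> does the same for
        \<open>\<beta>\<close>, and functoriality of \<open>G\<close> merges the three arrows into
        one argument.\<close>
      have "\<beta> \<cdot>\<^bsub>C\<^esub> (\<nu> W \<cdot>\<^bsub>C\<^esub> amap G f \<cdot>\<^bsub>C\<^esub> \<eta> V) \<cdot>\<^bsub>C\<^esub> \<alpha>
          = (\<beta> \<cdot>\<^bsub>C\<^esub> \<nu> W) \<cdot>\<^bsub>C\<^esub> (amap G f \<cdot>\<^bsub>C\<^esub> \<eta> V) \<cdot>\<^bsub>C\<^esub> \<alpha>"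
        by (rule left.source.Comp4_assoc[OF \<alpha> Gf\<eta> \<nu>[OF W] \<beta>])
      also have "(amap G f \<cdot>\<^bsub>C\<^esub> \<eta> V) \<cdot>\<^bsub>C\<^esub> \<alpha> = amap G f \<cdot>\<^bsub>C\<^esub> \<eta> V \<cdot>\<^bsub>C\<^esub> \<alpha>"
        by (rule left.source.Comp_assoc[OF \<alpha> \<eta>[OF V] Gf])
      also have "\<dots> = (amap G f \<cdot>\<^bsub>C\<^esub> amap G (amap F \<alpha>)) \<cdot>\<^bsub>C\<^esub> \<eta> V'"
        by (simp only: \<eta>_nat[OF \<alpha>, symmetric] left.source.Comp_assoc[OF \<eta>[OF V'] GF\<alpha> Gf])
      also have "amap G f \<cdot>\<^bsub>C\<^esub> amap G (amap F \<alpha>) = amap G (f \<cdot>\<^bsub>D\<^esub> amap F \<alpha>)"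
        by (rule right.amap_Comp[OF F\<alpha> f, symmetric])
      also have "\<beta> \<cdot>\<^bsub>C\<^esub> \<nu> W = \<nu> W' \<cdot>\<^bsub>C\<^esub> amap G (?t \<beta>)"
        by (rule \<nu>_nat[OF \<beta>])
      also have "(\<nu> W' \<cdot>\<^bsub>C\<^esub> amap G (?t \<beta>)) \<cdot>\<^bsub>C\<^esub> amap G (f \<cdot>\<^bsub>D\<^esub> amap F \<alpha>) \<cdot>\<^bsub>C\<^esub> \<eta> V'
          = \<nu> W' \<cdot>\<^bsub>C\<^esub> (amap G (?t \<beta>) \<cdot>\<^bsub>C\<^esub> amap G (f \<cdot>\<^bsub>D\<^esub> amap F \<alpha>)) \<cdot>\<^bsub>C\<^esub> \<eta> V'"
        by (rule left.source.Comp4_assoc[OF \<eta>[OF V'] Gf\<alpha> G\<beta> \<nu>[OF W'], symmetric])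
      also have "amap G (?t \<beta>) \<cdot>\<^bsub>C\<^esub> amap G (f \<cdot>\<^bsub>D\<^esub> amap F \<alpha>) = amap G (?t \<beta> \<cdot>\<^bsub>D\<^esub> f \<cdot>\<^bsub>D\<^esub> amap F \<alpha>)"
        by (rule right.amap_Comp[OF f\<alpha> T[OF \<beta>], symmetric])
      finally show "\<beta> \<cdot>\<^bsub>C\<^esub> (\<nu> W \<cdot>\<^bsub>C\<^esub> amap G f \<cdot>\<^bsub>C\<^esub> \<eta> V) \<cdot>\<^bsub>C\<^esub> \<alpha>
          = \<nu> W' \<cdot>\<^bsub>C\<^esub> amap G (?t \<beta> \<cdot>\<^bsub>D\<^esub> f \<cdot>\<^bsub>D\<^esub> amap F \<alpha>) \<cdot>\<^bsub>C\<^esub> \<eta> V'" .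
    qed
    \<comment> \<open>At \<open>V = W = P\<close> and \<open>f = \<theta> P\<close> the witness is
      literally the left side of \<open>\<nu>\<theta>\<close>.\<close>
    with \<nu>\<theta> show ?lhs by blast
  qed
qed

section \<open>The criterion for a right adjoint\<close>

text \<open>The composite of \<open>\<Theta>\<close> and \<open>G\<close> is treated as a single
  right adjoint, so an arrow from \<open>G V\<close> to \<open>\<Theta> (G W)\<close> transposes to
  one from \<open>L (G V)\<close> to \<open>W\<close>. Yoneda is now applied in \<open>W\<close>
  with \<open>V\<close> fixed, which is why the transformation leaves the identity functor instead
  of ending there. Keeping \<open>L\<close> abstract leaves the quasi-inverse out of the
  calculation.\<close>

lemma natural_hom_morphism_iff_unit_transformation:
  assumes "adjunction C D L (\<Theta> \<circ>\<^sub>F G) \<eta> \<epsilon>" and "cat_functor D C G" and "cat_functor C C \<Theta>"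
    and \<F>: "\<F> \<subseteq> Obj D"
    and \<theta>: "\<And>P. P \<in> \<F> \<Longrightarrow> \<theta> P \<in> Hom C (omap G P) (omap \<Theta> (omap G P))"
  shows "(\<exists>M. natural_hom_morphism D C G \<Theta> M \<and> (\<forall>P \<in> \<F>. M P P (\<theta> P) = Ident D P)) \<longleftrightarrow>
    (\<exists>\<xi>. nat_trans D D id_functor (L \<circ>\<^sub>F G) \<xi> \<and>
      (\<forall>P \<in> \<F>. \<epsilon> P \<cdot>\<^bsub>D\<^esub> amap L (\<theta> P) \<cdot>\<^bsub>D\<^esub> \<xi> P = Ident D P))"
    (is "?lhs \<longleftrightarrow> ?rhs")
proof -
  interpret adjunction C D L "\<Theta> \<circ>\<^sub>F G" \<eta> \<epsilon> by fact
  interpret G: cat_functor D C G by fact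
  interpret \<Theta>: cat_functor C C \<Theta> by fact
  note functors = left.omap_Obj G.omap_Obj \<Theta>.omap_Obj
  let ?T = "\<lambda>W. omap \<Theta> (omap G W)"
  let ?t = "\<lambda>f. amap \<Theta> (amap G f)"
  have T: "?t f \<in> Hom C (?T V) (?T W)" if "f \<in> Hom D V W" for f V W
    by (intro \<Theta>.amap_Hom G.amap_Hom that)
  have \<eta>: "\<eta> X \<in> Hom C X (?T (omap L X))" if "X \<in> Obj C" for X
    using unit.component_Hom[OF that] by simp
  have \<epsilon>: "\<epsilon> X \<in> Hom D (omap L (?T X)) X" if "X \<in> Obj D" for X
    using counit.component_Hom[OF that] by simp
  have \<epsilon>_nat: "f \<cdot>\<^bsub>D\<^esub> \<epsilon> X = \<epsilon> Y \<cdot>\<^bsub>D\<^esub> amap L (?t f)" if "f \<in> Hom D X Y" for f X Y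
    using counit.naturality[OF that] by simp
  have \<eta>_nat: "?t (amap L f) \<cdot>\<^bsub>C\<^esub> \<eta> X = \<eta> Y \<cdot>\<^bsub>C\<^esub> f" if "f \<in> Hom C X Y" for f X Y
    using unit.naturality[OF that] by simp
  show ?thesis
  proof
    assume ?lhs
    then obtain M where M: "natural_hom_morphism D C G \<Theta> M"
      and M\<theta>: "\<And>P. P \<in> \<F> \<Longrightarrow> M P P (\<theta> P) = Ident D P" by blast
    note pre = natural_hom_morphism_pre[OF M G.cat_functor_axioms \<Theta>.cat_functor_axioms]
    note post = natural_hom_morphism_post[OF M G.cat_functor_axioms \<Theta>.cat_functor_axioms]
    \<comment> \<open>\<open>\<eta> (G V)\<close> is the transpose of the identity of
      \<open>L (G V)\<close>; this is the universal element on this side.\<close>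
    define \<xi> where "\<xi> V = M V (omap L (omap G V)) (\<eta> (omap G V))" for V
    have \<xi>_Hom: "\<xi> V \<in> Hom D V (omap L (omap G V))" if "V \<in> Obj D" for V
      unfolding \<xi>_def by (intro natural_hom_morphism_Hom[OF M] functors \<eta> that)
    have "nat_trans D D id_functor (L \<circ>\<^sub>F G) \<xi>"
    proof (rule nat_trans.intro[OF cat_functor_id[OF left.target.category_axioms]
            cat_functor_comp[OF G.cat_functor_axioms left.cat_functor_axioms]])
      show "nat_trans_axioms D D id_functor (L \<circ>\<^sub>F G) \<xi>"
      proof
        fix X assume "X \<in> Obj D"
        then show "\<xi> X \<in> Hom D (omap id_functor X) (omap (L \<circ>\<^sub>F G) X)"
          using \<xi>_Hom by simp
      next
        fix f X Y assume f: "f \<in> Hom D X Y"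
        note X = left.target.Hom_ObjD(1)[OF f] and Y = left.target.Hom_ObjD(2)[OF f]
        note Gf = G.amap_Hom[OF f]
        \<comment> \<open>The order is \<open>post\<close> along \<open>L (G f)\<close>, naturality
          of \<open>\<eta>\<close> at \<open>G f\<close>, then \<open>pre\<close> along
          \<open>f\<close>.\<close>
        have "amap L (amap G f) \<cdot>\<^bsub>D\<^esub> \<xi> X
            = M X (omap L (omap G Y)) (?t (amap L (amap G f)) \<cdot>\<^bsub>C\<^esub> \<eta> (omap G X))"
          unfolding \<xi>_def by (intro post[OF left.amap_Hom[OF Gf]] functors \<eta> X)
        also have "\<dots> = M X (omap L (omap G Y)) (\<eta> (omap G Y) \<cdot>\<^bsub>C\<^esub> amap G f)"
          by (simp only: \<eta>_nat[OF Gf])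
        also have "\<dots> = \<xi> Y \<cdot>\<^bsub>D\<^esub> f"
          unfolding \<xi>_def by (intro pre[OF f, symmetric] functors \<eta> Y)
        finally show "amap (L \<circ>\<^sub>F G) f \<cdot>\<^bsub>D\<^esub> \<xi> X = \<xi> Y \<cdot>\<^bsub>D\<^esub> amap id_functor f"
          by simp
      qed
    qed
    moreover have "\<epsilon> P \<cdot>\<^bsub>D\<^esub> amap L (\<theta> P) \<cdot>\<^bsub>D\<^esub> \<xi> P = Ident D P" if "P \<in> \<F>" for P
    proof -
      have P: "P \<in> Obj D" using \<F> that by blast
      note \<theta>P = \<theta>[OF that]
      note GP = G.omap_Obj[OF P]
      note TP = \<Theta>.omap_Obj[OF GP]
      note L\<theta> = left.amap_Hom[OF \<theta>P]
      have "\<epsilon> P \<cdot>\<^bsub>D\<^esub> amap L (\<theta> P) \<cdot>\<^bsub>D\<^esub> \<xi> P = (\<epsilon> P \<cdot>\<^bsub>D\<^esub> amap L (\<theta> P)) \<cdot>\<^bsub>D\<^esub> \<xi> P"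
        by (rule left.target.Comp_assoc[OF \<xi>_Hom[OF P] L\<theta> \<epsilon>[OF P], symmetric])
      \<comment> \<open>\<open>\<epsilon> P \<cdot> L (\<theta> P)\<close> is the transpose of
        \<open>\<theta> P\<close>. Moved into the argument of \<open>M\<close> by
        \<open>post\<close>, it is transposed back to \<open>\<theta> P\<close> by naturality of
        \<open>\<eta>\<close> and the right triangle.\<close>
      also have "\<dots> = M P P (?t (\<epsilon> P \<cdot>\<^bsub>D\<^esub> amap L (\<theta> P)) \<cdot>\<^bsub>C\<^esub> \<eta> (omap G P))"
        unfolding \<xi>_def
        by (rule post[OF left.target.Comp_Hom[OF L\<theta> \<epsilon>[OF P]] P]) (intro functors \<eta> P)
      also have "?t (\<epsilon> P \<cdot>\<^bsub>D\<^esub> amap L (\<theta> P)) = ?t (\<epsilon> P) \<cdot>\<^bsub>C\<^esub> ?t (amap L (\<theta> P))"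
        using right.amap_Comp[OF L\<theta> \<epsilon>[OF P]] by simp
      also have "\<dots> \<cdot>\<^bsub>C\<^esub> \<eta> (omap G P) = ?t (\<epsilon> P) \<cdot>\<^bsub>C\<^esub> ?t (amap L (\<theta> P)) \<cdot>\<^bsub>C\<^esub> \<eta> (omap G P)"
        by (rule left.source.Comp_assoc[OF \<eta>[OF GP] T[OF L\<theta>] T[OF \<epsilon>[OF P]]])
      also have "?t (amap L (\<theta> P)) \<cdot>\<^bsub>C\<^esub> \<eta> (omap G P) = \<eta> (?T P) \<cdot>\<^bsub>C\<^esub> \<theta> P"
        by (rule \<eta>_nat[OF \<theta>P])
      also have "?t (\<epsilon> P) \<cdot>\<^bsub>C\<^esub> \<dots> = (?t (\<epsilon> P) \<cdot>\<^bsub>C\<^esub> \<eta> (?T P)) \<cdot>\<^bsub>C\<^esub> \<theta> P"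
        by (rule left.source.Comp_assoc[OF \<theta>P \<eta>[OF TP] T[OF \<epsilon>[OF P]], symmetric])
      also have "\<dots> = \<theta> P"
        using triangle_right[OF P] left.source.Ident_Comp[OF \<theta>P] by simp
      finally show ?thesis using M\<theta>[OF that] by simp
    qed
    ultimately show ?rhs by blast
  next
    assume ?rhs
    then obtain \<xi> where "nat_trans D D id_functor (L \<circ>\<^sub>F G) \<xi>"
      and \<xi>\<theta>: "\<And>P. P \<in> \<F> \<Longrightarrow> \<epsilon> P \<cdot>\<^bsub>D\<^esub> amap L (\<theta> P) \<cdot>\<^bsub>D\<^esub> \<xi> P = Ident D P" by blast
    interpret \<xi>: nat_trans D D id_functor "L \<circ>\<^sub>F G" \<xi> by fact
    have \<xi>: "\<xi> W \<in> Hom D W (omap L (omap G W))" if "W \<in> Obj D" for W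
      using \<xi>.component_Hom[OF that] by simp
    have \<xi>_nat: "amap L (amap G f) \<cdot>\<^bsub>D\<^esub> \<xi> X = \<xi> Y \<cdot>\<^bsub>D\<^esub> f" if "f \<in> Hom D X Y" for f X Y
      using \<xi>.naturality[OF that] by simp
    \<comment> \<open>Here \<open>\<xi> V\<close> comes first and the transpose of \<open>f\<close>,
      an arrow from \<open>L (G V)\<close> to \<open>W\<close>, follows.\<close>
    have "natural_hom_morphism D C G \<Theta> (\<lambda>V W f. \<epsilon> W \<cdot>\<^bsub>D\<^esub> amap L f \<cdot>\<^bsub>D\<^esub> \<xi> V)"
      unfolding natural_hom_morphism_def
    proof (intro conjI ballI)
      fix V W f assume "V \<in> Obj D" "W \<in> Obj D" "f \<in> Hom C (omap G V) (?T W)"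
      then show "\<epsilon> W \<cdot>\<^bsub>D\<^esub> amap L f \<cdot>\<^bsub>D\<^esub> \<xi> V \<in> Hom D V W"
        by (meson left.target.Comp_Hom \<epsilon> \<xi> left.amap_Hom)
    next
      fix V' V W W' \<alpha> \<beta> f
      assume V': "V' \<in> Obj D" and V: "V \<in> Obj D" and W: "W \<in> Obj D" and W': "W' \<in> Obj D"
        and \<alpha>: "\<alpha> \<in> Hom D V' V" and \<beta>: "\<beta> \<in> Hom D W W'"
        and f: "f \<in> Hom C (omap G V) (?T W)"
      note Lf = left.amap_Hom[OF f]
      note Lf\<xi> = left.target.Comp_Hom[OF \<xi>[OF V] Lf]
      note G\<alpha> = G.amap_Hom[OF \<alpha>]
      note LG\<alpha> = left.amap_Hom[OF G\<alpha>]
      note L\<beta> = left.amap_Hom[OF T[OF \<beta>]]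
      note f\<alpha> = left.source.Comp_Hom[OF G\<alpha> f]
      note Lf\<alpha> = left.amap_Hom[OF f\<alpha>]
      \<comment> \<open>Now \<open>\<alpha>\<close> passes under \<open>L\<close> by naturality of
        \<open>\<xi>\<close> and \<open>\<beta>\<close> by naturality of \<open>\<epsilon>\<close>;
        functoriality of \<open>L\<close> collects the three arrows.\<close>
      have "\<beta> \<cdot>\<^bsub>D\<^esub> (\<epsilon> W \<cdot>\<^bsub>D\<^esub> amap L f \<cdot>\<^bsub>D\<^esub> \<xi> V) \<cdot>\<^bsub>D\<^esub> \<alpha>
          = (\<beta> \<cdot>\<^bsub>D\<^esub> \<epsilon> W) \<cdot>\<^bsub>D\<^esub> (amap L f \<cdot>\<^bsub>D\<^esub> \<xi> V) \<cdot>\<^bsub>D\<^esub> \<alpha>"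
        by (rule left.target.Comp4_assoc[OF \<alpha> Lf\<xi> \<epsilon>[OF W] \<beta>])
      also have "(amap L f \<cdot>\<^bsub>D\<^esub> \<xi> V) \<cdot>\<^bsub>D\<^esub> \<alpha> = amap L f \<cdot>\<^bsub>D\<^esub> \<xi> V \<cdot>\<^bsub>D\<^esub> \<alpha>"
        by (rule left.target.Comp_assoc[OF \<alpha> \<xi>[OF V] Lf])
      also have "\<dots> = (amap L f \<cdot>\<^bsub>D\<^esub> amap L (amap G \<alpha>)) \<cdot>\<^bsub>D\<^esub> \<xi> V'"
        by (simp only: \<xi>_nat[OF \<alpha>, symmetric] left.target.Comp_assoc[OF \<xi>[OF V'] LG\<alpha> Lf])
      also have "amap L f \<cdot>\<^bsub>D\<^esub> amap L (amap G \<alpha>) = amap L (f \<cdot>\<^bsub>C\<^esub> amap G \<alpha>)"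
        by (rule left.amap_Comp[OF G\<alpha> f, symmetric])
      also have "\<beta> \<cdot>\<^bsub>D\<^esub> \<epsilon> W = \<epsilon> W' \<cdot>\<^bsub>D\<^esub> amap L (?t \<beta>)"
        by (rule \<epsilon>_nat[OF \<beta>])
      also have "(\<epsilon> W' \<cdot>\<^bsub>D\<^esub> amap L (?t \<beta>)) \<cdot>\<^bsub>D\<^esub> amap L (f \<cdot>\<^bsub>C\<^esub> amap G \<alpha>) \<cdot>\<^bsub>D\<^esub> \<xi> V'
          = \<epsilon> W' \<cdot>\<^bsub>D\<^esub> (amap L (?t \<beta>) \<cdot>\<^bsub>D\<^esub> amap L (f \<cdot>\<^bsub>C\<^esub> amap G \<alpha>)) \<cdot>\<^bsub>D\<^esub> \<xi> V'"
        by (rule left.target.Comp4_assoc[OF \<xi>[OF V'] Lf\<alpha> L\<beta> \<epsilon>[OF W'], symmetric])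
      also have "amap L (?t \<beta>) \<cdot>\<^bsub>D\<^esub> amap L (f \<cdot>\<^bsub>C\<^esub> amap G \<alpha>) = amap L (?t \<beta> \<cdot>\<^bsub>C\<^esub> f \<cdot>\<^bsub>C\<^esub> amap G \<alpha>)"
        by (rule left.amap_Comp[OF f\<alpha> T[OF \<beta>], symmetric])
      finally show "\<beta> \<cdot>\<^bsub>D\<^esub> (\<epsilon> W \<cdot>\<^bsub>D\<^esub> amap L f \<cdot>\<^bsub>D\<^esub> \<xi> V) \<cdot>\<^bsub>D\<^esub> \<alpha>
          = \<epsilon> W' \<cdot>\<^bsub>D\<^esub> amap L (?t \<beta> \<cdot>\<^bsub>C\<^esub> f \<cdot>\<^bsub>C\<^esub> amap G \<alpha>) \<cdot>\<^bsub>D\<^esub> \<xi> V'" .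
    qed
    with \<xi>\<theta> show ?lhs by blast
  qed
qed

section \<open>The two criteria\<close>

text \<open>The given triple itself witnesses \<open>twisted_separable\<close>, and the other
  clauses of the datum are assumed, so only the existence of \<open>M\<close> is at stake.\<close>

lemma twisted_separability_datum_iff:
  assumes "autoequivalence D \<Theta>" "generating C \<F>"
    and "\<forall>P \<in> \<F>. iso_arr D (omap F P) (omap \<Theta> (omap F P)) (\<theta> P)"
  shows "twisted_separable C D F \<and> twisted_separability_datum C D F \<Theta> \<F> \<theta> \<longleftrightarrow>
    (\<exists>M. natural_hom_morphism C D F \<Theta> M \<and> (\<forall>P \<in> \<F>. M P P (\<theta> P) = Ident C P))"
  using assms unfolding twisted_separable_def twisted_separability_datum_def by blast

theorem theorem3p1:
  fixes C :: "('o, 'a) cat" and D :: "('p, 'b) cat"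
    and F :: "('o, 'a, 'p, 'b) functr" and G :: "('p, 'b, 'o, 'a) functr"
    and \<eta> :: "'o \<Rightarrow> 'a" and \<epsilon> :: "'p \<Rightarrow> 'b"
  assumes "adjunction C D F G \<eta> \<epsilon>"
  shows "(\<forall>(\<Theta> :: ('p, 'b, 'p, 'b) functr) (\<F> :: 'o set) (\<theta> :: 'o \<Rightarrow> 'b).
        autoequivalence D \<Theta> \<and> generating C \<F> \<and>
        (\<forall>P \<in> \<F>. iso_arr D (omap F P) (omap \<Theta> (omap F P)) (\<theta> P)) \<longrightarrow>
        (twisted_separable C D F \<and> twisted_separability_datum C D F \<Theta> \<F> \<theta> \<longleftrightarrow>
         (\<exists>\<nu>. nat_trans C C (G \<circ>\<^sub>F \<Theta> \<circ>\<^sub>F F) id_functor \<nu> \<and>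
           (\<forall>P \<in> \<F>. \<nu> P \<cdot>\<^bsub>C\<^esub> amap G (\<theta> P) \<cdot>\<^bsub>C\<^esub> \<eta> P = Ident C P))))
    \<and> (\<forall>(\<Theta> :: ('o, 'a, 'o, 'a) functr) (\<F> :: 'p set) (\<theta> :: 'p \<Rightarrow> 'a)
         (\<Theta>' :: ('o, 'a, 'o, 'a) functr) (u :: 'o \<Rightarrow> 'a) (v :: 'o \<Rightarrow> 'a).
        autoequivalence C \<Theta> \<and> generating D \<F> \<and>
        (\<forall>P \<in> \<F>. iso_arr C (omap G P) (omap \<Theta> (omap G P)) (\<theta> P)) \<and>
        adjoint_equivalence C C \<Theta>' \<Theta> u v \<longrightarrow>
        (twisted_separable D C G \<and> twisted_separability_datum D C G \<Theta> \<F> \<theta> \<longleftrightarrow>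
         (\<exists>\<xi>. nat_trans D D id_functor (F \<circ>\<^sub>F \<Theta>' \<circ>\<^sub>F G) \<xi> \<and>
           (\<forall>P \<in> \<F>. \<epsilon> P \<cdot>\<^bsub>D\<^esub> amap F (v (omap G P) \<cdot>\<^bsub>C\<^esub> amap \<Theta>' (\<theta> P)) \<cdot>\<^bsub>D\<^esub> \<xi> P
              = Ident D P))))"
proof (intro conjI allI impI; elim conjE)
  fix \<Theta> :: "('p, 'b, 'p, 'b) functr" and \<F> \<theta>
  assume hyps: "autoequivalence D \<Theta>" "generating C \<F>"
    "\<forall>P \<in> \<F>. iso_arr D (omap F P) (omap \<Theta> (omap F P)) (\<theta> P)"
  show "twisted_separable C D F \<and> twisted_separability_datum C D F \<Theta> \<F> \<theta> \<longleftrightarrow>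
    (\<exists>\<nu>. nat_trans C C (G \<circ>\<^sub>F \<Theta> \<circ>\<^sub>F F) id_functor \<nu> \<and>
      (\<forall>P \<in> \<F>. \<nu> P \<cdot>\<^bsub>C\<^esub> amap G (\<theta> P) \<cdot>\<^bsub>C\<^esub> \<eta> P = Ident C P))"
    unfolding twisted_separability_datum_iff[OF hyps]
  proof (rule natural_hom_morphism_iff_counit_transformation[OF assms])
    show "cat_functor D D \<Theta>" using hyps(1) by (simp add: autoequivalence_def)
    show "\<F> \<subseteq> Obj C" using hyps(2) by (simp add: generating_def)
    show "\<theta> P \<in> Hom D (omap F P) (omap \<Theta> (omap F P))" if "P \<in> \<F>" for P
      using hyps(3) that by (simp add: iso_arr_def)
  qed
next
  fix \<Theta> \<Theta>' :: "('o, 'a, 'o, 'a) functr" and \<F> \<theta> u v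
  assume hyps: "autoequivalence C \<Theta>" "generating D \<F>"
    "\<forall>P \<in> \<F>. iso_arr C (omap G P) (omap \<Theta> (omap G P)) (\<theta> P)"
    and equiv: "adjoint_equivalence C C \<Theta>' \<Theta> u v"
  interpret adjunction C D F G \<eta> \<epsilon> by fact
  interpret equiv: adjoint_equivalence C C \<Theta>' \<Theta> u v by fact
  have \<F>: "\<F> \<subseteq> Obj D" using hyps(2) by (simp add: generating_def)
  have \<theta>: "\<theta> P \<in> Hom C (omap G P) (omap \<Theta> (omap G P))" if "P \<in> \<F>" for P
    using hyps(3) that by (simp add: iso_arr_def)
  \<comment> \<open>Functoriality of \<open>F\<close> splits the criterion as stated so that
    \<open>\<epsilon> P \<cdot> F (v (G P))\<close>, the counit of the composite adjunction, stands
    in front. The assumption on \<open>\<xi>\<close> supplies the type of \<open>\<xi> P\<close> for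
    the regrouping.\<close>
  have eq: "\<epsilon> P \<cdot>\<^bsub>D\<^esub> amap F (v (omap G P) \<cdot>\<^bsub>C\<^esub> amap \<Theta>' (\<theta> P)) \<cdot>\<^bsub>D\<^esub> \<xi> P
      = (\<epsilon> P \<cdot>\<^bsub>D\<^esub> amap F (v (omap G P))) \<cdot>\<^bsub>D\<^esub> amap (F \<circ>\<^sub>F \<Theta>') (\<theta> P) \<cdot>\<^bsub>D\<^esub> \<xi> P"
    if \<xi>: "nat_trans D D id_functor (F \<circ>\<^sub>F \<Theta>' \<circ>\<^sub>F G) \<xi>" and "P \<in> \<F>" for \<xi> P
  proof -
    have P: "P \<in> Obj D" using \<F> that by blast
    note GP = right.omap_Obj[OF P]
    have \<xi>P: "\<xi> P \<in> Hom D P (omap F (omap \<Theta>' (omap G P)))"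
      using nat_trans.component_Hom[OF \<xi> P] by simp
    have v: "v (omap G P) \<in> Hom C (omap \<Theta>' (omap \<Theta> (omap G P))) (omap G P)"
      using equiv.counit.component_Hom[OF GP] by simp
    have \<epsilon>: "\<epsilon> P \<in> Hom D (omap F (omap G P)) P"
      using counit.component_Hom[OF P] by simp
    note \<Theta>'\<theta> = equiv.left.amap_Hom[OF \<theta>[OF that(2)]]
    show ?thesis
      using left.target.Comp4_assoc[OF \<xi>P left.amap_Hom[OF \<Theta>'\<theta>] left.amap_Hom[OF v] \<epsilon>]
      by (simp add: left.amap_Comp[OF \<Theta>'\<theta> v])
  qed
  \<comment> \<open>\<open>\<circ>\<^sub>F\<close> associates to the right, whereas taking
    \<open>L\<close> to be \<open>F \<circ>\<^sub>F \<Theta>'\<close> produces the left bracketing;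
    both unfold to the same record.\<close>
  have comp: "(F \<circ>\<^sub>F \<Theta>') \<circ>\<^sub>F G = F \<circ>\<^sub>F \<Theta>' \<circ>\<^sub>F G"
    by (simp add: comp_functor_def)
  \<comment> \<open>The left adjoint of \<open>\<Theta> \<circ>\<^sub>F G\<close> is obtained by
    composing \<open>\<Theta>'\<close> left adjoint to \<open>\<Theta>\<close> with \<open>F\<close>
    left adjoint to \<open>G\<close>.\<close>
  have "(\<exists>M. natural_hom_morphism D C G \<Theta> M \<and> (\<forall>P \<in> \<F>. M P P (\<theta> P) = Ident D P)) \<longleftrightarrow>
    (\<exists>\<xi>. nat_trans D D id_functor ((F \<circ>\<^sub>F \<Theta>') \<circ>\<^sub>F G) \<xi> \<and>
      (\<forall>P \<in> \<F>. (\<epsilon> P \<cdot>\<^bsub>D\<^esub> amap F (v (omap G P))) \<cdot>\<^bsub>D\<^esub> amap (F \<circ>\<^sub>F \<Theta>') (\<theta> P) \<cdot>\<^bsub>D\<^esub> \<xi> P = Ident D P))"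
    by (rule natural_hom_morphism_iff_unit_transformation[OF
          adjunction_comp[OF equiv.adjunction_axioms adjunction_axioms]
          right.cat_functor_axioms equiv.right.cat_functor_axioms \<F> \<theta>])
  then show "twisted_separable D C G \<and> twisted_separability_datum D C G \<Theta> \<F> \<theta> \<longleftrightarrow>
    (\<exists>\<xi>. nat_trans D D id_functor (F \<circ>\<^sub>F \<Theta>' \<circ>\<^sub>F G) \<xi> \<and>
      (\<forall>P \<in> \<F>. \<epsilon> P \<cdot>\<^bsub>D\<^esub> amap F (v (omap G P) \<cdot>\<^bsub>C\<^esub> amap \<Theta>' (\<theta> P)) \<cdot>\<^bsub>D\<^esub> \<xi> P = Ident D P))"
    \<comment> \<open>\<open>eq\<close> holds for transformations \<open>\<xi>\<close> only;
      \<open>conj_cong\<close> makes the first conjunct available while the second is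
      rewritten.\<close>
    unfolding twisted_separability_datum_iff[OF hyps] comp using eq by (simp cong: conj_cong)
qed

end
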